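(* Let $f:X\to Y$ be a continuous map and let $B\subseteq X$. Then $TC^S(f,B)\le TC^P(f,B)$.
   Context: For a topological space $X$, $PX=X^I$ is the space of continuous paths $[0,1]\to X$ with the compact-open topology, and for $B\subseteq X$, $P_{X\times B}=\{\gamma\in PX:\gamma(1)\in B\}$. Let $f:X\to Y$ be continuous and $B\subseteq X$. $TC^S(f,B)$ is the least integer $n\ge0$ such that $X\times B$ has an open cover $U_0,\dots,U_n$ with, for each $i$, a continuous map $\sigma_i:U_i\to P_{Y\times f(B)}$ satisfying $\sigma_i(x,b)(0)=f(x)$ and $\sigma_i(x,b)(1)=f(b)$ ($\infty$ if there is none). $TC^P(f,B)$ is the least integer $n\ge 0$ such that $X\times f(B)$ has an open cover $U_0,\dots,U_n$ with, for each $i$, a continuous map $s_i:U_i\to P_{X\times B}$ satisfying $\pi_{f(B)}s_i=\mathrm{id}_{U_i}$, where $\pi_{f(B)}:P_{X\times B}\to X\times f(B)$, $\pi_{f(B)}(\gamma)=(\gamma(0),f(\gamma(1)))$ ($\infty$ if there is none). *)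

theory Defs
  imports "HOL-Analysis.Analysis" "HOL-Library.Extended_Nat"
begin

text \<open>
  Points of the path space are taken in \<^term>\<open>extensional {0..1::real}\<close>, so that two paths are
  equal as soon as they agree on the unit interval. The topology is the compact-open one: the sets
  of paths mapping a compact \<open>K \<subseteq> [0,1]\<close> into an open \<open>U \<subseteq> X\<close> form a subbasis (\<open>K = {}\<close> gives
  the whole path space).
\<close>

definition path_space :: "'a topology \<Rightarrow> (real \<Rightarrow> 'a) topology" where
  "path_space X = topology_generated_by
     {{\<gamma> \<in> extensional {0..1}. pathin X \<gamma> \<and> \<gamma> ` K \<subseteq> U} | K U.
        compactin (top_of_set {0..1}) K \<and> openin X U}"

lemma topspace_path_space:
  "topspace (path_space X) = {\<gamma> \<in> extensional {0..1}. pathin X \<gamma>}"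
proof -
  have "compactin (top_of_set {0..1::real}) {}" "openin X {}" by auto
  then have "{\<gamma> \<in> extensional {0..1}. pathin X \<gamma>} \<in>
     {{\<gamma> \<in> extensional {0..1}. pathin X \<gamma> \<and> \<gamma> ` K \<subseteq> U} | K U.
        compactin (top_of_set {0..1}) K \<and> openin X U}"
    by (intro CollectI exI[of _ "{}"]) auto
  then show ?thesis
    unfolding path_space_def topology_generated_by_topspace by blast
qed

text \<open>The space \<open>P\<^bsub>X\<times>B\<^esub>\<close> of paths in \<open>X\<close> that end in \<open>B\<close>.\<close>

definition path_space_into :: "'a topology \<Rightarrow> 'a set \<Rightarrow> (real \<Rightarrow> 'a) topology" where
  "path_space_into X B = subtopology (path_space X) {\<gamma>. \<gamma> 1 \<in> B}"

definition end_map :: "('a \<Rightarrow> 'b) \<Rightarrow> (real \<Rightarrow> 'a) \<Rightarrow> 'a \<times> 'b" where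
  "end_map f \<gamma> = (\<gamma> 0, f (\<gamma> 1))"

definition open_cover_upto :: "'a topology \<Rightarrow> nat \<Rightarrow> (nat \<Rightarrow> 'a set) \<Rightarrow> bool" where
  "open_cover_upto Z n U \<longleftrightarrow> (\<forall>i\<le>n. openin Z (U i)) \<and> (\<Union>i\<le>n. U i) = topspace Z"

text \<open>In both invariants the infimum of the empty set in \<^typ>\<open>enat\<close> is \<open>\<infinity>\<close>.\<close>

definition TC_S :: "'a topology \<Rightarrow> 'b topology \<Rightarrow> ('a \<Rightarrow> 'b) \<Rightarrow> 'a set \<Rightarrow> enat" where
  "TC_S X Y f B = Inf {enat n | n.
     \<exists>U. open_cover_upto (prod_topology X (subtopology X B)) n U \<and>
       (\<forall>i\<le>n. \<exists>\<sigma>.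
          continuous_map (subtopology (prod_topology X (subtopology X B)) (U i))
            (path_space_into Y (f ` B)) \<sigma> \<and>
          (\<forall>(x, b) \<in> U i. \<sigma> (x, b) 0 = f x \<and> \<sigma> (x, b) 1 = f b))}"

definition TC_P :: "'a topology \<Rightarrow> 'b topology \<Rightarrow> ('a \<Rightarrow> 'b) \<Rightarrow> 'a set \<Rightarrow> enat" where
  "TC_P X Y f B = Inf {enat n | n.
     \<exists>U. open_cover_upto (prod_topology X (subtopology Y (f ` B))) n U \<and>
       (\<forall>i\<le>n. \<exists>s.
          continuous_map (subtopology (prod_topology X (subtopology Y (f ` B))) (U i))
            (path_space_into X B) s \<and>
          (\<forall>u \<in> U i. end_map f (s u) = u))}"

end

theory Submission
  imports Defs
begin

text \<open>
  A motion planner for \<open>TC\<^sup>P\<close> becomes one for \<open>TC\<^sup>S\<close> by changing variables on both sides. The map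
  \<open>id \<times> f : X \<times> B \<rightarrow> X \<times> f(B)\<close> pulls an open cover of \<open>X \<times> f(B)\<close> back to one of \<open>X \<times> B\<close> with the same
  number of members, and post-composition \<open>\<gamma> \<mapsto> f \<circ> \<gamma>\<close> maps \<open>P\<^bsub>X\<times>B\<^esub>\<close> continuously to \<open>P\<^bsub>Y\<times>f(B)\<^esub>\<close>.
  If \<open>s\<close> is a local section of \<open>\<pi>\<^bsub>f(B)\<^esub>\<close>, then \<open>s(x, f b)\<close> starts at \<open>x\<close> and ends at
  some point of the fibre \<open>f\<^sup>-\<^sup>1(f b)\<close>, not necessarily at \<open>b\<close>; applying \<open>f\<close> removes this ambiguity, so
  \<open>\<sigma>(x, b) = f \<circ> s(x, f b)\<close> runs from \<open>f x\<close> to \<open>f b\<close>. Hence every \<open>n\<close> admissible for \<open>TC\<^sup>P\<close> is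
  admissible for \<open>TC\<^sup>S\<close>.
\<close>

text \<open>
  Paths are extensional on the unit interval, so the composite is cut off outside it. Continuity
  holds because \<open>f \<circ> \<gamma>\<close> maps \<open>K\<close> into \<open>U\<close> exactly when \<open>\<gamma>\<close> maps \<open>K\<close> into the open set \<open>f\<^sup>-\<^sup>1(U)\<close>:
  preimages of subbasic sets are subbasic, with the same \<open>K\<close>.
\<close>

lemma continuous_map_path_space_postcomp:
  assumes f: "continuous_map X Y f"
  shows "continuous_map (path_space X) (path_space Y) (\<lambda>\<gamma>. restrict (f \<circ> \<gamma>) {0..1})"
    (is "continuous_map _ _ ?F")
proof -
  have F_path: "pathin Y (?F \<gamma>)" if "pathin X \<gamma>" for \<gamma>
  proof -
    have "continuous_map (top_of_set {0..1::real}) Y (f \<circ> \<gamma>)"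
      using that f unfolding pathin_def by (rule continuous_map_compose)
    then show ?thesis
      unfolding pathin_def by (rule continuous_map_eq) auto
  qed
  have pre: "openin (path_space X)
      (?F -` {\<gamma> \<in> extensional {0..1}. pathin Y \<gamma> \<and> \<gamma> ` K \<subseteq> U} \<inter> topspace (path_space X))"
    if K: "compactin (top_of_set {0..1::real}) K" and U: "openin Y U" for K U
  proof -
    let ?V = "{x \<in> topspace X. f x \<in> U}"
    have V: "openin X ?V"
      using f U by (rule openin_continuous_map_preimage)
    have K01: "K \<subseteq> {0..1}"
      using compactin_subset_topspace[OF K] by simp
    have mem: "\<gamma> t \<in> topspace X" if "pathin X \<gamma>" "t \<in> K" for \<gamma> t
      using that K01 unfolding pathin_def continuous_map_def by auto
    have "?F -` {\<gamma> \<in> extensional {0..1}. pathin Y \<gamma> \<and> \<gamma> ` K \<subseteq> U} \<inter> topspace (path_space X)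
        = {\<gamma> \<in> extensional {0..1}. pathin X \<gamma> \<and> \<gamma> ` K \<subseteq> ?V}" (is "?L = ?R")
    proof (rule set_eqI)
      fix \<gamma> :: "real \<Rightarrow> 'a"
      have "?F \<gamma> ` K = f ` \<gamma> ` K"
        using K01 by (auto simp: image_image intro!: image_cong)
      then have "?F \<gamma> ` K \<subseteq> U \<longleftrightarrow> \<gamma> ` K \<subseteq> ?V" if "pathin X \<gamma>"
        using mem[OF that] by auto
      moreover have "?F \<gamma> \<in> extensional {0..1}"
        by simp
      ultimately show "\<gamma> \<in> ?L \<longleftrightarrow> \<gamma> \<in> ?R"
        using F_path[of \<gamma>] unfolding topspace_path_space by blast
    qed
    also have "openin (path_space X) \<dots>"
      unfolding path_space_def by (rule topology_generated_by_Basis) (use K V in blast)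
    finally show ?thesis .
  qed
  have into: "?F ` topspace (path_space X) \<subseteq> topspace (path_space Y)"
    using F_path by (auto simp: topspace_path_space)
  show ?thesis
    unfolding path_space_def[of Y]
  proof (rule continuous_on_generated_topo)
    show "?F ` topspace (path_space X) \<subseteq>
        \<Union>{{\<gamma> \<in> extensional {0..1}. pathin Y \<gamma> \<and> \<gamma> ` K \<subseteq> U} | K U.
           compactin (top_of_set {0..1}) K \<and> openin Y U}"
      using into unfolding path_space_def[of Y] topology_generated_by_topspace .
  qed (use pre in blast)
qed

lemma continuous_map_path_space_into_postcomp:
  assumes "continuous_map X Y f"
  shows "continuous_map (path_space_into X B) (path_space_into Y (f ` B))
           (\<lambda>\<gamma>. restrict (f \<circ> \<gamma>) {0..1})"
  unfolding path_space_into_def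
  by (rule continuous_map_into_subtopology)
     (use continuous_map_path_space_postcomp[OF assms] in
       \<open>auto intro: continuous_map_from_subtopology\<close>)

lemma continuous_map_id_times:
  assumes f: "continuous_map X Y f"
  shows "continuous_map (prod_topology X (subtopology X B)) (prod_topology X (subtopology Y (f ` B)))
           (map_prod id f)"
proof -
  have "continuous_map (subtopology X B) (subtopology Y (f ` B)) f"
    by (rule continuous_map_into_subtopology)
       (use f in \<open>auto intro: continuous_map_from_subtopology\<close>)
  then show ?thesis
    unfolding map_prod_def by (simp add: continuous_map_prod_top id_def)
qed

lemma open_cover_upto_preimage:
  assumes g: "continuous_map Z W g" and U: "open_cover_upto W n U"
  shows "open_cover_upto Z n (\<lambda>i. {z \<in> topspace Z. g z \<in> U i})"
proof -
  have "\<exists>i\<le>n. g z \<in> U i" if "z \<in> topspace Z" for z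
  proof -
    have "g z \<in> topspace W"
      using g that by (auto simp: continuous_map_def)
    then show ?thesis
      using U unfolding open_cover_upto_def by blast
  qed
  then have "(\<Union>i\<le>n. {z \<in> topspace Z. g z \<in> U i}) = topspace Z"
    by auto
  moreover have "openin Z {z \<in> topspace Z. g z \<in> U i}" if "i \<le> n" for i
    using U that openin_continuous_map_preimage[OF g] by (simp add: open_cover_upto_def)
  ultimately show ?thesis
    by (simp add: open_cover_upto_def)
qed

theorem proposition5p4:
  fixes X :: "'a topology" and Y :: "'b topology" and f :: "'a \<Rightarrow> 'b" and B :: "'a set"
  assumes "continuous_map X Y f" and "B \<subseteq> topspace X"
  shows "TC_S X Y f B \<le> TC_P X Y f B"
  unfolding TC_S_def TC_P_def
proof (rule Inf_superset_mono, safe)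
  let ?Z = "prod_topology X (subtopology X B)"
  let ?W = "prod_topology X (subtopology Y (f ` B))"
  let ?g = "map_prod id f"
  fix n U
  assume U: "open_cover_upto ?W n U"
    and s_ex: "\<forall>i\<le>n. \<exists>s. continuous_map (subtopology ?W (U i)) (path_space_into X B) s \<and>
          (\<forall>u\<in>U i. end_map f (s u) = u)"
  define V where "V i = {z \<in> topspace ?Z. ?g z \<in> U i}" for i
  have g: "continuous_map ?Z ?W ?g"
    using assms(1) by (rule continuous_map_id_times)
  have V: "open_cover_upto ?Z n V"
    using open_cover_upto_preimage[OF g U] unfolding V_def .
  have "\<exists>\<sigma>. continuous_map (subtopology ?Z (V i)) (path_space_into Y (f ` B)) \<sigma> \<and>
          (\<forall>(x, b) \<in> V i. \<sigma> (x, b) 0 = f x \<and> \<sigma> (x, b) 1 = f b)" if "i \<le> n" for i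
  proof -
    obtain s where s: "continuous_map (subtopology ?W (U i)) (path_space_into X B) s"
      and ends: "\<And>u. u \<in> U i \<Longrightarrow> end_map f (s u) = u"
      using s_ex \<open>i \<le> n\<close> by blast
    let ?\<sigma> = "(\<lambda>\<gamma>. restrict (f \<circ> \<gamma>) {0..1}) \<circ> (s \<circ> ?g)"
    have "continuous_map (subtopology ?Z (V i)) (subtopology ?W (U i)) ?g"
      by (rule continuous_map_into_subtopology)
         (use g in \<open>auto simp: V_def intro: continuous_map_from_subtopology\<close>)
    then have "continuous_map (subtopology ?Z (V i)) (path_space_into Y (f ` B)) ?\<sigma>"
      by (intro continuous_map_compose[OF _ continuous_map_path_space_into_postcomp[OF assms(1)]]
            continuous_map_compose[OF _ s])
    moreover have "?\<sigma> (x, b) 0 = f x \<and> ?\<sigma> (x, b) 1 = f b" if "(x, b) \<in> V i" for x b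
    proof -
      have "(x, f b) \<in> U i"
        using that by (simp add: V_def)
      then show ?thesis
        using ends[of "(x, f b)"] by (simp add: end_map_def)
    qed
    ultimately show ?thesis by blast
  qed
  with V show "\<exists>m. enat n = enat m \<and> (\<exists>U. open_cover_upto ?Z m U \<and>
       (\<forall>i\<le>m. \<exists>\<sigma>. continuous_map (subtopology ?Z (U i)) (path_space_into Y (f ` B)) \<sigma> \<and>
          (\<forall>(x, b) \<in> U i. \<sigma> (x, b) 0 = f x \<and> \<sigma> (x, b) 1 = f b)))"
    by blast
qed

end
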